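(* For every sufficiently small $\varepsilon\in(0,1)$ and every integer $r\ge 1/\varepsilon^5$, the following holds: for all sufficiently large $n$, there is a balanced $r$-colouring of the edges of $K_n$ such that, in every copy in $K_n$ of a $\lceil 1/\varepsilon\rceil$-caterpillar on $n$ vertices, the number of edges in colour $1$ is smaller than the number of edges in one of the colours $2,\dots,r$.
   Context: An $r$-colouring is an edge-colouring with colours in $\{1,\dots,r\}$. It is balanced if the numbers of edges in any two different colours differ by at most $1$. For an integer $\ell\ge 1$, an $\ell$-caterpillar is a tree in which every vertex lies within distance $1$ of a central path of length $\ell$ (that is, with $\ell$ edges and $\ell+1$ vertices), and the degrees of the vertices in this central path differ by at most $1$. A copy of a graph in $K_n$ is a subgraph of $K_n$ isomorphic to it. "Sufficiently large $n$" may depend on $\varepsilon$ and $r$. *)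

theory Defs
  imports Complex_Main
begin

text \<open>A graph is a pair of a vertex set and a set of edges, an edge being an unordered pair
  of distinct vertices. All graphs are finite.\<close>

type_synonym 'a graph = "'a set \<times> 'a set set"

abbreviation verts :: "'a graph \<Rightarrow> 'a set" where
  "verts G \<equiv> fst G"

abbreviation edges :: "'a graph \<Rightarrow> 'a set set" where
  "edges G \<equiv> snd G"

definition simple_graph :: "'a graph \<Rightarrow> bool" where
  "simple_graph G \<longleftrightarrow> finite (verts G) \<and> (\<forall>e\<in>edges G. e \<subseteq> verts G \<and> card e = 2)"

definition complete_graph :: "nat \<Rightarrow> nat graph" where
  "complete_graph n = ({..<n}, {e. e \<subseteq> {..<n} \<and> card e = 2})"

definition degree :: "'a graph \<Rightarrow> 'a \<Rightarrow> nat" where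
  "degree G v = card {e \<in> edges G. v \<in> e}"

text \<open>Walks, paths and cycles are given by their vertex sequences, so a walk with
  \<open>k\<close> edges is a list of length \<open>k + 1\<close>. The closing edge of a cycle is not repeated in the list.\<close>

definition is_walk :: "'a graph \<Rightarrow> 'a list \<Rightarrow> bool" where
  "is_walk G p \<longleftrightarrow> p \<noteq> [] \<and> set p \<subseteq> verts G \<and> successively (\<lambda>u v. {u, v} \<in> edges G) p"

definition is_path :: "'a graph \<Rightarrow> 'a list \<Rightarrow> bool" where
  "is_path G p \<longleftrightarrow> is_walk G p \<and> distinct p"

definition is_cycle :: "'a graph \<Rightarrow> 'a list \<Rightarrow> bool" where
  "is_cycle G p \<longleftrightarrow> is_path G p \<and> 3 \<le> length p \<and> {last p, hd p} \<in> edges G"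

definition connected_graph :: "'a graph \<Rightarrow> bool" where
  "connected_graph G \<longleftrightarrow> verts G \<noteq> {} \<and>
     (\<forall>u\<in>verts G. \<forall>v\<in>verts G. \<exists>p. is_walk G p \<and> hd p = u \<and> last p = v)"

definition is_tree :: "'a graph \<Rightarrow> bool" where
  "is_tree G \<longleftrightarrow> simple_graph G \<and> connected_graph G \<and> (\<nexists>p. is_cycle G p)"

text \<open>Only meaningful for vertices in the same component.\<close>

definition graph_dist :: "'a graph \<Rightarrow> 'a \<Rightarrow> 'a \<Rightarrow> nat" where
  "graph_dist G u v = (LEAST k. \<exists>p. is_walk G p \<and> hd p = u \<and> last p = v \<and> length p = k + 1)"

definition caterpillar :: "nat \<Rightarrow> 'a graph \<Rightarrow> bool" where
  "caterpillar l G \<longleftrightarrow> is_tree G \<and>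
     (\<exists>p. is_path G p \<and> length p = l + 1 \<and>
          (\<forall>v\<in>verts G. \<exists>u\<in>set p. graph_dist G v u \<le> 1) \<and>
          (\<forall>u\<in>set p. \<forall>v\<in>set p. degree G u \<le> degree G v + 1))"

definition subgraph :: "'a graph \<Rightarrow> 'a graph \<Rightarrow> bool" where
  "subgraph S G \<longleftrightarrow> simple_graph S \<and> verts S \<subseteq> verts G \<and> edges S \<subseteq> edges G"

definition isomorphic :: "'a graph \<Rightarrow> 'b graph \<Rightarrow> bool" where
  "isomorphic G H \<longleftrightarrow> (\<exists>f. bij_betw f (verts G) (verts H) \<and>
     (\<forall>u\<in>verts G. \<forall>v\<in>verts G. {u, v} \<in> edges G \<longleftrightarrow> {f u, f v} \<in> edges H))"

definition is_copy :: "'a graph \<Rightarrow> 'b graph \<Rightarrow> 'a graph \<Rightarrow> bool" where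
  "is_copy S H G \<longleftrightarrow> subgraph S G \<and> isomorphic S H"

text \<open>The values of a colouring outside the edge set are irrelevant.\<close>

definition edge_colouring :: "nat \<Rightarrow> 'a graph \<Rightarrow> ('a set \<Rightarrow> nat) \<Rightarrow> bool" where
  "edge_colouring r G c \<longleftrightarrow> (\<forall>e\<in>edges G. c e \<in> {1..r})"

definition colour_count :: "'a graph \<Rightarrow> ('a set \<Rightarrow> nat) \<Rightarrow> nat \<Rightarrow> nat" where
  "colour_count G c i = card {e \<in> edges G. c e = i}"

definition balanced_colouring :: "nat \<Rightarrow> 'a graph \<Rightarrow> ('a set \<Rightarrow> nat) \<Rightarrow> bool" where
  "balanced_colouring r G c \<longleftrightarrow> edge_colouring r G c \<and>
     (\<forall>i\<in>{1..r}. \<forall>j\<in>{1..r}. colour_count G c i \<le> colour_count G c j + 1)"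

end

theory Submission
  imports Defs
begin

text \<open>Every edge of a caterpillar \<open>S\<close> meets its spine, which has \<open>l + 1\<close> vertices, and some spine
  vertex has degree about \<open>n / l\<close> or more. So it suffices that colour 1 has maximum degree
  \<open>O(n / r)\<close>, which gives at most \<open>O(l n / r)\<close> edges of colour 1 in \<open>S\<close>, while every vertex of
  \<open>K\<^sub>n\<close> sees only \<open>O(sqrt r)\<close> colours: by pigeonhole some colour then occurs at least
  \<open>n / O(l sqrt r)\<close> times in \<open>S\<close>, which is more since \<open>sqrt r\<close> is much larger than \<open>l\<^sup>2\<close>.

  To get such a balanced colouring, list first the edges \<open>{x, y}\<close> with \<open>\<bar>x - y\<bar> \<le> d\<close>, \<open>d\<close> about
  \<open>n / r\<close>, and then the others grouped by the residues of their end points modulo \<open>m\<close>, \<open>m\<close> about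
  \<open>sqrt r\<close>. Cut this list into \<open>r\<close> consecutive classes of equal size. Colour 1 lies in the first
  group; every group has \<open>O(n\<^sup>2 / r)\<close> edges and thus meets \<open>O(1)\<close> classes, and the edges at a
  vertex lie in at most \<open>2 m + 1\<close> groups.\<close>

section \<open>Monotone colourings with prescribed class sizes\<close>

text \<open>Greedy construction: each step adds an element of least \<open>f\<close>-value among
  those left. Level sets of \<open>f\<close> may be cut anywhere, which is why every size
  \<open>k\<close> is attainable.\<close>

lemma exists_initial_segment:
  fixes f :: "'a \<Rightarrow> 'b::linorder"
  assumes "finite E" "k \<le> card E"
  shows "\<exists>A\<subseteq>E. card A = k \<and> (\<forall>a\<in>A. \<forall>b\<in>E - A. f a \<le> f b)"
  using assms(2)
proof (induction k)
  case 0
  then show ?case by (intro exI[of _ "{}"]) auto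
next
  case (Suc k)
  then obtain A where A: "A \<subseteq> E" "card A = k" "\<forall>a\<in>A. \<forall>b\<in>E - A. f a \<le> f b" by auto
  have fin: "finite (E - A)" "finite A" using assms(1) A(1) finite_subset by auto
  have ne: "E - A \<noteq> {}" using A Suc.prems by auto
  define x where "x = arg_min_on f (E - A)"
  have x: "x \<in> E - A" "\<And>y. y \<in> E - A \<Longrightarrow> f x \<le> f y"
    unfolding x_def using arg_min_if_finite(1)[OF fin(1) ne, of f] arg_min_least[OF fin(1) ne, of _ f] by auto
  show ?case
    using A x fin by (intro exI[of _ "insert x A"]) auto
qed

text \<open>Sorting \<open>E\<close> by \<open>f\<close> and cutting it into consecutive blocks. The
  induction peels off the last block: colour \<open>Suc r\<close> gets what an initial segment
  leaves over. A level set may be split between colours, so monotonicity is asserted only for strict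
  inequality of keys.\<close>

lemma exists_monotone_colouring:
  fixes f :: "'a \<Rightarrow> 'b::linorder" and r :: nat
  assumes "finite E" "(\<Sum>i\<in>{1..r}. s i) = card E"
  shows "\<exists>c. (\<forall>e\<in>E. c e \<in> {1..r}) \<and> (\<forall>i\<in>{1..r}. card {e \<in> E. c e = i} = s i) \<and>
    (\<forall>e\<in>E. \<forall>e'\<in>E. f e < f e' \<longrightarrow> c e \<le> c e')"
  using assms
proof (induction r arbitrary: E)
  case 0
  then show ?case by simp
next
  case (Suc r)
  have le: "(\<Sum>i\<in>{1..r}. s i) \<le> card E" using Suc.prems(2) by simp
  obtain A where A: "A \<subseteq> E" "card A = (\<Sum>i\<in>{1..r}. s i)" "\<forall>a\<in>A. \<forall>b\<in>E - A. f a \<le> f b"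
    using exists_initial_segment[OF Suc.prems(1) le] by metis
  have "finite A" using A(1) Suc.prems(1) finite_subset by auto
  with Suc.IH[of A] A(2) obtain c where c: "\<And>e. e\<in>A \<Longrightarrow> c e \<in> {1..r}"
    "\<And>i. i\<in>{1..r} \<Longrightarrow> card {e \<in> A. c e = i} = s i"
    "\<And>e e'. e \<in> A \<Longrightarrow> e'\<in>A \<Longrightarrow> f e < f e' \<Longrightarrow> c e \<le> c e'" by metis
  define c' where "c' = (\<lambda>e. if e \<in> A then c e else Suc r)"
  have "card {e \<in> E. c' e = i} = s i" if "i \<in> {1..Suc r}" for i
  proof (cases "i = Suc r")
    case True
    have "{e \<in> E. c' e = i} = E - A" using c(1) by (force simp: c'_def True)
    then show ?thesis using True A(1,2) Suc.prems \<open>finite A\<close> by (simp add: card_Diff_subset)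
  next
    case False
    then have "{e \<in> E. c' e = i} = {e \<in> A. c e = i}" using A(1) by (auto simp: c'_def)
    then show ?thesis using False that c(2)[of i] by auto
  qed
  moreover have "c' e \<in> {1..Suc r}" if "e \<in> E" for e using c(1)[of e] that by (auto simp: c'_def)
  moreover have "c' e \<le> c' e'" if "e \<in> E" "e' \<in> E" "f e < f e'" for e e'
    using that c(1)[of e] c(3)[of e e'] A(3) by (force simp: c'_def)
  ultimately show ?case by blast
qed

text \<open>Every colour strictly between the extreme colours of a level set of \<open>f\<close> is used only inside
  that level set.\<close>

lemma card_colours_level_set:
  fixes f :: "'a \<Rightarrow> 'b::linorder" and c :: "'a \<Rightarrow> nat"
  assumes "finite E" and range: "\<forall>e\<in>E. c e \<in> {1..r}"
    and size: "\<forall>i\<in>{1..r}. s \<le> card {e \<in> E. c e = i}"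
    and mono: "\<forall>e\<in>E. \<forall>e'\<in>E. f e < f e' \<longrightarrow> c e \<le> c e'"
    and less: "card {e \<in> E. f e = k} < q * s"
  shows "card (c ` {e \<in> E. f e = k}) \<le> q + 1"
proof (cases "{e \<in> E. f e = k} = {}")
  case True
  then show ?thesis by (simp only: image_empty card.empty)
next
  case False
  let ?B = "{e \<in> E. f e = k}"
  let ?K = "c ` ?B"
  have fin: "finite ?K" "finite ?B" using assms(1) by auto
  define lo where "lo = Min ?K"
  define hi where "hi = Max ?K"
  have "lo \<in> ?K" "hi \<in> ?K" using False fin Min_in Max_in by (simp_all add: lo_def hi_def)
  then obtain e1 e2 where e: "e1 \<in> ?B" "c e1 = lo" "e2 \<in> ?B" "c e2 = hi" by blast
  have K: "?K \<subseteq> {lo..hi}" using fin by (auto simp: lo_def hi_def)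
  have sub: "{e \<in> E. c e = j} \<subseteq> ?B" if j: "j \<in> {lo<..<hi}" for j
  proof
    fix x assume x: "x \<in> {e \<in> E. c e = j}"
    \<comment> \<open>A key below \<open>k\<close> would force \<open>c x\<close> \<le>
      \<open>c e1\<close> = \<open>lo\<close>, and a key above \<open>k\<close> would force
      \<open>hi\<close> = \<open>c e2\<close> \<le> \<open>c x\<close>.\<close>
    have "\<not> f x < k" using mono x e j by force
    moreover have "\<not> f x > k" using mono x e j by force
    ultimately show "x \<in> ?B" using x by auto
  qed
  have in_range: "j \<in> {1..r}" if "j \<in> {lo<..<hi}" for j using that e range by force
  have "card {lo<..<hi} * s \<le> (\<Sum>j\<in>{lo<..<hi}. card {e \<in> E. c e = j})"
    using sum_bounded_below[of "{lo<..<hi}" s "\<lambda>j. card {e \<in> E. c e = j}"] size in_range by simp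
  also have "\<dots> = card (\<Union>j\<in>{lo<..<hi}. {e \<in> E. c e = j})"
    using assms(1) by (subst card_UN_disjoint) auto
  also have "\<dots> \<le> card ?B" using sub fin by (intro card_mono UN_least)
  also note less
  \<comment> \<open>At most \<open>q - 1\<close> colours lie strictly inside; the end points
    \<open>lo\<close> and \<open>hi\<close> raise the bound to \<open>q + 1\<close>.\<close>
  finally have "card {lo<..<hi} < q" by (metis mult_le_mono1 not_le)
  moreover have "card ?K \<le> card {lo..hi}" using K card_mono by blast
  ultimately show ?thesis by simp
qed

section \<open>The band of short edges and the grouping of edges by residues\<close>

lemma pair_eq_Min_Max:
  fixes e :: "'a::linorder set"
  assumes "card e = 2"
  shows "e = {Min e, Max e}" "Min e < Max e"
proof -
  obtain x y where xy: "e = {x, y}" "x \<noteq> y" using assms by (auto simp: card_2_iff)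
  show "e = {Min e, Max e}" "Min e < Max e" using xy by (auto simp: min_def max_def)
qed

lemma card_residue_class:
  assumes "0 < (m::nat)"
  shows "card {x. x < n \<and> x mod m = a} \<le> n div m + 1"
proof -
  have "inj_on (\<lambda>x. x div m) {x. x < n \<and> x mod m = a}"
    by (rule inj_onI) (metis (mono_tags, lifting) mem_Collect_eq div_mult_mod_eq)
  then have "card {x. x < n \<and> x mod m = a} \<le> card {..n div m}"
    by (rule card_inj_on_le) (auto intro: div_le_mono)
  then show ?thesis by simp
qed

lemma finite_edges_complete_graph [simp]: "finite (edges (complete_graph n))"
  by (rule finite_subset[of _ "Pow {..<n}"]) (auto simp: complete_graph_def)

lemma card_edges_complete_graph: "2 * card (edges (complete_graph n)) = n * (n - 1)"
proof -
  have "card (edges (complete_graph n)) = n choose 2"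
    using n_subsets[of "{..<n}" 2] by (simp add: complete_graph_def)
  moreover have "even (n * (n - 1))" by (cases n) auto
  ultimately show ?thesis by (simp add: choose_two)
qed

text \<open>A nearly regular reservoir for colour 1: the total is of order \<open>n * d\<close>, yet
  no vertex meets more than about \<open>2 * d\<close> of these edges.\<close>

definition short_edges :: "nat \<Rightarrow> nat \<Rightarrow> nat set set" where
  "short_edges n d = {e \<in> edges (complete_graph n). Max e \<le> Min e + d}"

lemma card_short_edges_upper: "card (short_edges n d) \<le> n * d"
proof -
  have "short_edges n d \<subseteq> (\<lambda>(x, k). {x, x + k}) ` ({..<n} \<times> {1..d})"
  proof
    fix e assume e: "e \<in> short_edges n d"
    then have "card e = 2" "e \<subseteq> {..<n}" by (auto simp: short_edges_def complete_graph_def)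
    note p = pair_eq_Min_Max[OF this(1)]
    have "Min e < n" using p(1) \<open>e \<subseteq> {..<n}\<close> by blast
    moreover have "e = {Min e, Min e + (Max e - Min e)}" using p by simp
    ultimately show "e \<in> (\<lambda>(x, k). {x, x + k}) ` ({..<n} \<times> {1..d})"
      using p e by (intro image_eqI[of _ _ "(Min e, Max e - Min e)"]) (auto simp: short_edges_def)
  qed
  then have "card (short_edges n d) \<le> card ({..<n} \<times> {1..d})"
    by (meson finite_SigmaI finite_lessThan finite_atLeastAtMost surj_card_le)
  then show ?thesis by simp
qed

text \<open>Only smaller end points below \<open>n - d\<close> are counted, since for these all
  \<open>d\<close> larger partners exist. This guarantees that the band can hold all of colour
  1.\<close>

lemma card_short_edges_lower: "(n - d) * d \<le> card (short_edges n d)"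
proof -
  have "card ({..<n - d} \<times> {1..d}) \<le> card (short_edges n d)"
  proof (rule card_inj_on_le[where f = "\<lambda>(x, k). {x, x + k}"])
    show "inj_on (\<lambda>(x, k). {x, x + k}) ({..<n - d} \<times> {1..d})"
      by (auto simp: inj_on_def doubleton_eq_iff)
    show "(\<lambda>(x, k). {x, x + k}) ` ({..<n - d} \<times> {1..d}) \<subseteq> short_edges n d"
      by (auto simp: short_edges_def complete_graph_def)
    show "finite (short_edges n d)" by (simp add: short_edges_def)
  qed
  then show ?thesis by simp
qed

lemma card_short_edges_at: "card {e \<in> short_edges n d. v \<in> e} \<le> 2 * d + 1"
proof -
  have "{e \<in> short_edges n d. v \<in> e} \<subseteq> (\<lambda>u. {v, u}) ` {v - d..v + d}"
  proof
    fix e assume e: "e \<in> {e \<in> short_edges n d. v \<in> e}"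
    then have "card e = 2" by (auto simp: short_edges_def complete_graph_def)
    note p = pair_eq_Min_Max[OF this]
    have "v = Min e \<or> v = Max e" using e p(1) by blast
    then show "e \<in> (\<lambda>u. {v, u}) ` {v - d..v + d}"
    proof
      assume v: "v = Min e"
      have "e = {v, Max e}" using p(1) v by simp
      then show ?thesis using p(2) e v by (intro image_eqI[of _ _ "Max e"]) (auto simp: short_edges_def)
    next
      assume v: "v = Max e"
      have "e = {v, Min e}" using p(1) v by (simp add: insert_commute)
      then show ?thesis using p(2) e v by (intro image_eqI[of _ _ "Min e"]) (auto simp: short_edges_def)
    qed
  qed
  then have "card {e \<in> short_edges n d. v \<in> e} \<le> card {v - d..v + d}"
    by (meson finite_atLeastAtMost surj_card_le)
  then show ?thesis by simp
qed

text \<open>Key 0 puts the band first in the order. Any other key is, up to the shift by 1, a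
  two-digit number in base \<open>m\<close> whose digits are the residues of the smaller and the
  larger end point.\<close>

definition edge_key :: "nat \<Rightarrow> nat \<Rightarrow> nat set \<Rightarrow> nat" where
  "edge_key m d e = (if Max e \<le> Min e + d then 0 else Suc (m * (Min e mod m) + Max e mod m))"

lemma card_edge_key_0: "card {e \<in> edges (complete_graph n). edge_key m d e = 0} \<le> n * d"
proof -
  have "{e \<in> edges (complete_graph n). edge_key m d e = 0} = short_edges n d"
    by (auto simp: edge_key_def short_edges_def split: if_splits)
  then show ?thesis using card_short_edges_upper[of n d] by simp
qed

text \<open>The digits \<open>t div m\<close> and \<open>t mod m\<close> recover the residues of
  both end points, and each residue class has at most \<open>n div m + 1\<close> members below
  \<open>n\<close>.\<close>

lemma card_edge_key_Suc:
  assumes "0 < m"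
  shows "card {e \<in> edges (complete_graph n). edge_key m d e = Suc t} \<le> (n div m + 1)\<^sup>2"
proof -
  let ?A = "\<lambda>a. {x. x < n \<and> x mod m = a}"
  have "{e \<in> edges (complete_graph n). edge_key m d e = Suc t}
    \<subseteq> (\<lambda>(x, y). {x, y}) ` (?A (t div m) \<times> ?A (t mod m))"
  proof
    fix e assume e: "e \<in> {e \<in> edges (complete_graph n). edge_key m d e = Suc t}"
    then have "card e = 2" and sub: "e \<subseteq> {..<n}" by (auto simp: complete_graph_def)
    note p = pair_eq_Min_Max[OF this(1)]
    have "Min e \<in> e" "Max e \<in> e" using p(1) by blast+
    then have lt: "Min e < n" "Max e < n" using sub by auto
    have t: "t = m * (Min e mod m) + Max e mod m" using e by (auto simp: edge_key_def split: if_splits)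
    have "t div m = Min e mod m" "t mod m = Max e mod m" using assms by (simp_all add: t)
    then show "e \<in> (\<lambda>(x, y). {x, y}) ` (?A (t div m) \<times> ?A (t mod m))"
      using p lt by (intro image_eqI[of _ _ "(Min e, Max e)"]) auto
  qed
  then have "card {e \<in> edges (complete_graph n). edge_key m d e = Suc t}
    \<le> card (?A (t div m) \<times> ?A (t mod m))"
    by (rule surj_card_le[rotated]) auto
  also have "\<dots> \<le> (n div m + 1) * (n div m + 1)"
    unfolding card_cartesian_product using assms by (intro mult_le_mono card_residue_class)
  finally show ?thesis by (simp add: power2_eq_square)
qed

text \<open>With \<open>v\<close> as smaller or as larger end point, one digit of the key is fixed
  and the other takes at most \<open>m\<close> values; key 0 adds one. This is the saving from about
  \<open>m\<^sup>2\<close> groups to about \<open>2 * m\<close> at a single vertex.\<close>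

lemma card_edge_keys_at:
  assumes "0 < m"
  shows "card (edge_key m d ` {e \<in> edges (complete_graph n). v \<in> e}) \<le> 2 * m + 1"
proof -
  let ?X = "insert 0 ((\<lambda>b. Suc (m * (v mod m) + b)) ` {..<m} \<union> (\<lambda>a. Suc (m * a + v mod m)) ` {..<m})"
  have "edge_key m d ` {e \<in> edges (complete_graph n). v \<in> e} \<subseteq> ?X"
  proof
    fix k assume "k \<in> edge_key m d ` {e \<in> edges (complete_graph n). v \<in> e}"
    then obtain e where e: "e \<in> edges (complete_graph n)" "v \<in> e" "k = edge_key m d e" by auto
    then have "card e = 2" by (auto simp: complete_graph_def)
    then have "v = Min e \<or> v = Max e" using e(2) pair_eq_Min_Max(1)[of e] by blast
    then show "k \<in> ?X" using assms e(3) by (auto simp: edge_key_def)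
  qed
  then have "card (edge_key m d ` {e \<in> edges (complete_graph n). v \<in> e}) \<le> card ?X"
    by (intro card_mono) auto
  also have "\<dots> \<le> Suc (card ((\<lambda>b. Suc (m * (v mod m) + b)) ` {..<m} \<union> (\<lambda>a. Suc (m * a + v mod m)) ` {..<m}))"
    by (intro card_insert_le_m1) auto
  also have "\<dots> \<le> Suc (card ((\<lambda>b. Suc (m * (v mod m) + b)) ` {..<m}) + card ((\<lambda>a. Suc (m * a + v mod m)) ` {..<m}))"
    by (intro Suc_leI le_imp_less_Suc card_Un_le)
  also have "\<dots> \<le> Suc (m + m)"
    using card_image_le[of "{..<m}" "\<lambda>b. Suc (m * (v mod m) + b)"]
      card_image_le[of "{..<m}" "\<lambda>a. Suc (m * a + v mod m)"] by simp
  finally show ?thesis by simp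
qed

section \<open>Numerical estimates and the local balanced colouring\<close>

lemma real_div_bounds:
  assumes "0 < (m::nat)"
  shows "real m * real (n div m) \<le> real n" "real n < real m * (real (n div m) + 1)"
proof -
  have "m * (n div m) \<le> n" "n < m * (n div m + 1)"
    using assms dividend_less_div_times[of m n] by (simp_all add: mult.commute)
  then have "real (m * (n div m)) \<le> real n" "real n < real (m * (n div m + 1))"
    by (simp_all only: of_nat_le_iff of_nat_less_iff)
  then show "real m * real (n div m) \<le> real n" "real n < real m * (real (n div m) + 1)"
    by (simp_all add: algebra_simps)
qed

text \<open>To leading order \<open>s\<close> is \<open>n\<^sup>2 / (2 * r)\<close>, while the band
  and every residue group have at most about \<open>n\<^sup>2 / r\<close> edges, so
  \<open>4 * s\<close> leaves a factor 2 to spare. The hypothesis \<open>100 * r \<le> n\<close>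
  absorbs all rounding errors.\<close>

lemma key_class_bounds:
  fixes n r m s :: nat
  assumes r: "4 \<le> r" and m: "r \<le> m\<^sup>2" "m \<le> r" and n: "100 * r \<le> n"
    and d_def: "d = n div r + 1" and M: "2 * M = n * (n - 1)" and s_def: "s = M div r"
  shows "n * d < 4 * s" "(n div m + 1)\<^sup>2 < 4 * s" "s + 1 \<le> (n - d) * d"
    "real (2 * d + 1) \<le> 3 * real n / real r"
proof -
  define R N where "R = real r" and "N = real n"
  have R: "4 \<le> R" "100 * R \<le> N" using r n by (simp_all add: R_def N_def)
  have m0: "0 < m" using r m by (cases m) auto
  have "real M = N * (N - 1) / 2"
  proof -
    have "2 * real M = real (n * (n - 1))" using M by (metis of_nat_mult of_nat_numeral)
    then show ?thesis using n r by (simp add: N_def of_nat_diff)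
  qed
  then have s1: "R * real s \<le> N * (N - 1) / 2" and s2: "N * (N - 1) / 2 < R * (real s + 1)"
    using real_div_bounds[of r M] r by (simp_all add: s_def R_def)
  have d1: "real d \<le> N / R + 1" and d2: "N / R < real d"
    using real_div_bounds[of r n] r by (simp_all add: d_def R_def N_def field_simps)
  define P where "P = N * N"
  have P: "100 * (N * R) \<le> P" "400 * N \<le> P" "40000 * R \<le> P"
  proof -
    show "100 * (N * R) \<le> P" using mult_left_mono[OF R(2), of N] R by (simp add: P_def algebra_simps)
    show "400 * N \<le> P" unfolding P_def using R by (intro mult_right_mono) auto
    then show "40000 * R \<le> P" using R by linarith
  qed
  have half: "N * (N - 1) / 2 = P / 2 - N / 2" by (simp add: P_def algebra_simps diff_divide_distrib)
  \<comment> \<open>The loss \<open>N / 2 + R\<close> against \<open>P / 2\<close> is below one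
    hundredth of \<open>P\<close> by the bounds in \<open>P\<close>.\<close>
  have s3: "49 / 100 * P \<le> R * real s"
    using s2 P R unfolding half distrib_left by linarith
  have "R * (N * real d) \<le> P + N * R"
    using mult_left_mono[OF d1, of "R * N"] R by (simp add: P_def algebra_simps)
  also have "\<dots> < 4 * (49 / 100 * P)" using P R by linarith
  also have "\<dots> \<le> R * (4 * real s)" using s3 by simp
  finally have "N * real d < 4 * real s" using R by simp
  then have "real (n * d) < real (4 * s)" by (simp add: N_def)
  then show "n * d < 4 * s" by (simp only: of_nat_less_iff)
  show "real (2 * d + 1) \<le> 3 * real n / real r"
  proof -
    have "3 \<le> N / R" using R by (simp add: field_simps)
    then have "2 * real d + 1 \<le> 3 * (N / R)" using d1 by simp
    then show ?thesis by (simp add: N_def R_def)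
  qed
  show "s + 1 \<le> (n - d) * d"
  proof -
    \<comment> \<open>Since \<open>R\<close> is at least 4, the factor \<open>N - real d\<close>
      stays above \<open>3 / 4 * N - 1\<close>, comfortably more than the half of \<open>N\<close>
      that \<open>s\<close> requires.\<close>
    have dN: "real d \<le> N / 4 + 1"
    proof -
      have "N / R \<le> N / 4" using R by (intro divide_left_mono) auto
      then show ?thesis using d1 by linarith
    qed
    then have "d \<le> n" using R by (simp add: N_def)
    have "N * (3 / 4 * N - 1) = 3 / 4 * P - N" by (simp add: P_def algebra_simps)
    then have "R * (real s + 1) \<le> N * (3 / 4 * N - 1)"
      using s1 P R unfolding half distrib_left by linarith
    also have "\<dots> \<le> N * (N - real d)" using dN R by (intro mult_left_mono) auto
    also have "\<dots> \<le> (R * real d) * (N - real d)"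
      using d2 R dN by (intro mult_right_mono) (auto simp: field_simps)
    finally have "R * (real s + 1) \<le> R * ((N - real d) * real d)" by (simp add: mult_ac)
    then have "real s + 1 \<le> (N - real d) * real d" using R by simp
    then have "real (s + 1) \<le> real ((n - d) * d)" using \<open>d \<le> n\<close> by (simp add: N_def of_nat_diff)
    then show ?thesis by (simp only: of_nat_le_iff)
  qed
  show "(n div m + 1)\<^sup>2 < 4 * s"
  proof -
    have mR: "R \<le> (real m)\<^sup>2" "real m \<le> R" using m by (simp_all add: R_def flip: of_nat_power)
    have "real (n div m + 1) \<le> N / real m + 1" using real_div_bounds[of m n] m0 by (simp add: N_def field_simps)
    \<comment> \<open>From \<open>m \<le> r\<close> and \<open>100 * r \<le> n\<close>, the quotient
      \<open>N / real m\<close> is at least 100, so the added 1 costs one per cent.\<close>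
    also have "\<dots> \<le> 101 / 100 * (N / real m)" using R mR m0 by (simp add: field_simps)
    finally have "(real (n div m + 1))\<^sup>2 \<le> (101 / 100 * (N / real m))\<^sup>2" by (intro power_mono) auto
    also have "\<dots> = (101 / 100)\<^sup>2 * (N\<^sup>2 / (real m)\<^sup>2)" by (simp add: power_mult_distrib power_divide)
    also have "\<dots> \<le> (101 / 100)\<^sup>2 * (N\<^sup>2 / R)" using mR R by (intro mult_left_mono frac_le) auto
    also have "\<dots> < 4 * (49 / 100 * P / R)"
    proof -
      have "0 < N\<^sup>2 / R" using R by simp
      then show ?thesis by (simp add: P_def power2_eq_square)
    qed
    also have "\<dots> \<le> 4 * real s" using s3 R by (simp add: field_simps)
    finally have "real ((n div m + 1)\<^sup>2) < real (4 * s)" by simp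
    then show ?thesis by (simp only: of_nat_less_iff)
  qed
qed

lemma sum_balanced_parts:
  assumes "0 < (r::nat)"
  shows "(\<Sum>i\<in>{1..r}. M div r + (if i \<le> M mod r then 1 else 0)) = M"
proof -
  have "{1..r} \<inter> {i. i \<le> M mod r} = {1..M mod r}"
    using mod_less_divisor[OF assms, of M] by auto
  then show ?thesis by (simp add: sum.distrib sum.If_cases)
qed

text \<open>The colouring is monotone in \<open>edge_key\<close>, with classes of size
  \<open>s\<close> or \<open>s + 1\<close>. Colour 1 is confined to the band, which bounds its
  degrees; the few keys at a vertex, each meeting at most 5 colours, bound the colours seen
  there.\<close>

lemma exists_local_balanced_colouring:
  fixes n r m :: nat
  assumes r: "4 \<le> r" and m: "r \<le> m\<^sup>2" "m \<le> r" and n: "100 * r \<le> n"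
  shows "\<exists>c. balanced_colouring r (complete_graph n) c \<and>
    (\<forall>v. real (card {e \<in> edges (complete_graph n). v \<in> e \<and> c e = 1}) \<le> 3 * real n / real r) \<and>
    (\<forall>v. card (c ` {e \<in> edges (complete_graph n). v \<in> e}) \<le> 15 * m)"
proof -
  let ?E = "edges (complete_graph n)"
  have m0: "0 < m" using r m by (cases m) auto
  define d s where "d = n div r + 1" and "s = card ?E div r"
  note bounds = key_class_bounds[OF r m n d_def card_edges_complete_graph s_def]
  define sz where "sz = (\<lambda>i. s + (if i \<le> card ?E mod r then 1 else 0))"
  have sum: "(\<Sum>i\<in>{1..r}. sz i) = card ?E"
    unfolding sz_def s_def using r by (intro sum_balanced_parts) simp
  obtain c where c: "\<forall>e\<in>?E. c e \<in> {1..r}" "\<forall>i\<in>{1..r}. card {e \<in> ?E. c e = i} = sz i"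
    "\<forall>e\<in>?E. \<forall>e'\<in>?E. edge_key m d e < edge_key m d e' \<longrightarrow> c e \<le> c e'"
    using exists_monotone_colouring[OF finite_edges_complete_graph sum, of "edge_key m d"] by blast
  have bal: "balanced_colouring r (complete_graph n) c"
    using c(1,2) by (simp add: balanced_colouring_def edge_colouring_def colour_count_def sz_def)
  have key0: "edge_key m d e = 0 \<longleftrightarrow> e \<in> short_edges n d" if "e \<in> ?E" for e
    using that by (auto simp: edge_key_def short_edges_def)
  have short: "e \<in> short_edges n d" if e: "e \<in> ?E" "c e = 1" for e
  proof (rule ccontr)
    assume not: "e \<notin> short_edges n d"
    \<comment> \<open>An edge of colour 1 outside the band would force the whole band into colour 1,
      making that class larger than \<open>s + 1\<close>.\<close>
    have "c e' = 1" if e': "e' \<in> short_edges n d" for e'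
    proof -
      have "e' \<in> ?E" using e' by (simp add: short_edges_def)
      then have "c e' \<le> c e" using key0 e e' not c(3) by (metis gr_zeroI)
      then show ?thesis using e c(1) \<open>e' \<in> ?E\<close> by force
    qed
    then have "insert e (short_edges n d) \<subseteq> {e \<in> ?E. c e = 1}"
      using e by (auto simp: short_edges_def)
    then have "card (insert e (short_edges n d)) \<le> card {e \<in> ?E. c e = 1}" by (intro card_mono) auto
    moreover have "card (insert e (short_edges n d)) = Suc (card (short_edges n d))"
      using not by (simp add: short_edges_def)
    moreover have "card {e \<in> ?E. c e = 1} \<le> s + 1" using c(2) r by (simp add: sz_def)
    ultimately show False using card_short_edges_lower[of n d] bounds(3) by simp
  qed
  have "real (card {e \<in> ?E. v \<in> e \<and> c e = 1}) \<le> 3 * real n / real r" for v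
  proof -
    have "card {e \<in> ?E. v \<in> e \<and> c e = 1} \<le> card {e \<in> short_edges n d. v \<in> e}"
      using short by (intro card_mono) (auto simp: short_edges_def)
    also have "\<dots> \<le> 2 * d + 1" by (rule card_short_edges_at)
    finally show ?thesis using bounds(4) by linarith
  qed
  moreover have "card (c ` {e \<in> ?E. v \<in> e}) \<le> 15 * m" for v
  proof -
    let ?K = "edge_key m d ` {e \<in> ?E. v \<in> e}"
    have lvl: "card (c ` {e \<in> ?E. edge_key m d e = k}) \<le> 5" for k
    proof -
      have "card {e \<in> ?E. edge_key m d e = k} < 4 * s"
        using le_less_trans[OF card_edge_key_0 bounds(1)]
          le_less_trans[OF card_edge_key_Suc[OF m0] bounds(2)]
        by (cases k) simp_all
      then show ?thesis
        using card_colours_level_set[OF _ c(1) _ c(3), of s k 4] c(2) by (simp add: sz_def)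
    qed
    have "card (c ` {e \<in> ?E. v \<in> e}) \<le> card (\<Union>k\<in>?K. c ` {e \<in> ?E. edge_key m d e = k})"
      by (intro card_mono) auto
    also have "\<dots> \<le> (\<Sum>k\<in>?K. card (c ` {e \<in> ?E. edge_key m d e = k}))"
      by (intro card_UN_le) auto
    also have "\<dots> \<le> card ?K * 5" using sum_bounded_above[of ?K, OF lvl] by simp
    \<comment> \<open>As \<open>m\<close> is positive, \<open>10 * m + 5\<close> is at most
      \<open>15 * m\<close>.\<close>
    also have "\<dots> \<le> (2 * m + 1) * 5" by (intro mult_le_mono1 card_edge_keys_at m0)
    finally show ?thesis using m0 by simp
  qed
  ultimately show ?thesis using bal by blast
qed

section \<open>Spines of caterpillars and of their copies\<close>

lemma graph_dist_le_1:
  assumes "connected_graph G" "u \<in> verts G" "v \<in> verts G" "graph_dist G v u \<le> 1"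
  shows "u = v \<or> {u, v} \<in> edges G"
proof -
  let ?P = "\<lambda>k. \<exists>p. is_walk G p \<and> hd p = v \<and> last p = u \<and> length p = k + 1"
  \<comment> \<open>Connectedness supplies some walk, without which the \<open>LEAST\<close> in
    \<open>graph_dist\<close> would say nothing; then the minimum is attained by a walk with at most
    two vertices.\<close>
  obtain p where p: "is_walk G p" "hd p = v" "last p = u"
    using assms unfolding connected_graph_def by blast
  then have "?P (length p - 1)" by (intro exI[of _ p]) (auto simp: is_walk_def Suc_le_eq)
  then have "?P (graph_dist G v u)" unfolding graph_dist_def by (rule LeastI)
  then obtain q where q: "is_walk G q" "hd q = v" "last q = u" "length q \<le> 2" "q \<noteq> []"
    using assms(4) by (auto simp: is_walk_def)
  then consider x where "q = [x]" | x y where "q = [x, y]"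
    by (cases q; cases "tl q") (auto simp: neq_Nil_conv)
  then show ?thesis using q by cases (auto simp: is_walk_def insert_commute)
qed

lemma is_path_infix: "is_path G (xs @ ys @ zs) \<Longrightarrow> ys \<noteq> [] \<Longrightarrow> is_path G ys"
  by (auto simp: is_path_def is_walk_def successively_append_iff)

lemma is_path_rev: "is_path G p \<Longrightarrow> is_path G (rev p)"
  by (auto simp: is_path_def is_walk_def insert_commute)

text \<open>The slice of \<open>p\<close> between the positions of \<open>x\<close> and
  \<open>y\<close>, reversed if \<open>y\<close> comes first.\<close>

lemma exists_subpath:
  assumes "is_path G p" "x \<in> set p" "y \<in> set p"
  shows "\<exists>q. is_path G q \<and> hd q = x \<and> last q = y \<and> set q \<subseteq> set p"
proof -
  obtain i j where ij: "i < length p" "p ! i = x" "j < length p" "p ! j = y"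
    using assms by (metis in_set_conv_nth)
  have main: "\<exists>q. is_path G q \<and> hd q = p ! i \<and> last q = p ! j \<and> set q \<subseteq> set p"
    if "i \<le> j" "j < length p" for i j
  proof -
    let ?q = "drop i (take (Suc j) p)"
    have ne: "?q \<noteq> []" using that by simp
    have "p = take i p @ ?q @ drop (Suc j) p"
      using that by (metis append.assoc append_take_drop_id le_SucI min.absorb1 take_take)
    then have "is_path G ?q" using assms(1) ne is_path_infix by metis
    moreover have "hd ?q = p ! i" using that by (simp add: hd_drop_conv_nth)
    moreover have "last ?q = p ! j" using that by (simp add: last_drop take_Suc_conv_app_nth)
    moreover have "set ?q \<subseteq> set p" by (meson set_drop_subset set_take_subset subset_trans)
    ultimately show ?thesis by blast
  qed
  show ?thesis
  proof (cases "i \<le> j")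
    case True
    then show ?thesis using main ij by blast
  next
    case False
    then obtain q where q: "is_path G q" "hd q = y" "last q = x" "set q \<subseteq> set p"
      using main[of j i] ij by auto
    then show ?thesis
      using is_path_rev[of G q] by (intro exI[of _ "rev q"]) (auto simp: hd_rev last_rev)
  qed
qed

text \<open>An edge avoiding the spine would close a cycle with the spine.\<close>

lemma caterpillar_spine:
  assumes "caterpillar l G"
  shows "\<exists>Q. Q \<subseteq> verts G \<and> card Q = l + 1 \<and> (\<forall>e\<in>edges G. e \<inter> Q \<noteq> {}) \<and>
    (\<forall>v\<in>verts G - Q. \<exists>u\<in>Q. {u, v} \<in> edges G)"
proof -
  obtain p where tree: "is_tree G" and p: "is_path G p" "length p = l + 1"
    and near: "\<forall>v\<in>verts G. \<exists>u\<in>set p. graph_dist G v u \<le> 1"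
    using assms unfolding caterpillar_def by blast
  have simple: "simple_graph G" and conn: "connected_graph G" and acyc: "\<nexists>p. is_cycle G p"
    using tree by (auto simp: is_tree_def)
  have sub: "set p \<subseteq> verts G" using p by (auto simp: is_path_def is_walk_def)
  have dom: "\<exists>u\<in>set p. {u, v} \<in> edges G" if "v \<in> verts G - set p" for v
    using near that graph_dist_le_1[OF conn _ _] sub by blast
  have cover: "e \<inter> set p \<noteq> {}" if e: "e \<in> edges G" for e
  proof
    assume disj: "e \<inter> set p = {}"
    obtain a b where ab: "e = {a, b}" "a \<noteq> b"
      using simple e unfolding simple_graph_def by (metis card_2_iff)
    have abG: "a \<in> verts G - set p" "b \<in> verts G - set p"
      using simple e ab disj unfolding simple_graph_def by blast+
    obtain x y where xy: "x \<in> set p" "{x, a} \<in> edges G" "y \<in> set p" "{y, b} \<in> edges G"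
      using dom abG by meson
    obtain q where q: "is_path G q" "hd q = x" "last q = y" "set q \<subseteq> set p"
      using exists_subpath[OF p(1) xy(1,3)] by blast
    \<comment> \<open>The closing edge is \<open>e\<close> itself. Both \<open>a\<close> and
      \<open>b\<close> lie off the spine, so no vertex repeats; if \<open>x = y\<close>, the cycle
      is a triangle.\<close>
    have "is_cycle G (a # q @ [b])"
      using q xy ab abG e
      by (auto simp: is_cycle_def is_path_def is_walk_def successively_Cons successively_append_iff
          insert_commute Suc_le_eq)
    then show False using acyc by blast
  qed
  have "card (set p) = l + 1" using p by (simp add: is_path_def distinct_card)
  then show ?thesis using sub dom cover by blast
qed

text \<open>The spine of \<open>H\<close> is pulled back along the isomorphism \<open>f\<close>,
  which preserves its size, the covering of edges and the domination of the other vertices.\<close>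

lemma copy_caterpillar_spine:
  assumes cat: "caterpillar l H" and copy: "is_copy S H G"
  shows "\<exists>Q. Q \<subseteq> verts S \<and> card Q = l + 1 \<and> (\<forall>e\<in>edges S. e \<inter> Q \<noteq> {}) \<and>
    (\<forall>v\<in>verts S - Q. \<exists>u\<in>Q. {u, v} \<in> edges S)"
proof -
  obtain Q where Q: "Q \<subseteq> verts H" "card Q = l + 1" "\<forall>e\<in>edges H. e \<inter> Q \<noteq> {}"
    "\<forall>v\<in>verts H - Q. \<exists>u\<in>Q. {u, v} \<in> edges H"
    using caterpillar_spine[OF cat] by blast
  obtain f where f: "bij_betw f (verts S) (verts H)"
    "\<forall>u\<in>verts S. \<forall>v\<in>verts S. {u, v} \<in> edges S \<longleftrightarrow> {f u, f v} \<in> edges H"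
    using copy unfolding is_copy_def isomorphic_def by blast
  have simple: "simple_graph S" using copy by (simp add: is_copy_def subgraph_def)
  let ?Q = "{x \<in> verts S. f x \<in> Q}"
  have "f ` ?Q = Q" using f(1) Q(1) unfolding bij_betw_def by (auto 0 3)
  moreover have "inj_on f ?Q" using f(1) by (auto simp: bij_betw_def inj_on_def)
  ultimately have "card ?Q = l + 1" using Q(2) card_image by metis
  moreover have "e \<inter> ?Q \<noteq> {}" if e: "e \<in> edges S" for e
  proof -
    obtain a b where ab: "e = {a, b}" "a \<in> verts S" "b \<in> verts S"
      using simple e unfolding simple_graph_def by (metis card_2_iff insert_subset)
    then have "{f a, f b} \<inter> Q \<noteq> {}" using e f(2) Q(3) by blast
    then show ?thesis using ab by auto
  qed
  moreover have "\<exists>u\<in>?Q. {u, v} \<in> edges S" if v: "v \<in> verts S - ?Q" for v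
  proof -
    have "f v \<in> verts H - Q" using v f(1) by (auto simp: bij_betw_def)
    then obtain w where "w \<in> Q" "{w, f v} \<in> edges H" using Q(4) by blast
    moreover from this(1) obtain u where "u \<in> ?Q" "w = f u" using \<open>f ` ?Q = Q\<close> by (metis (lifting) imageE)
    ultimately show ?thesis using f(2) v by (intro bexI[of _ u]) auto
  qed
  ultimately show ?thesis by (intro exI[of _ ?Q]) auto
qed

section \<open>Counting colours in a copy of a caterpillar\<close>

text \<open>Averaging: the closed neighbourhoods of the vertices of \<open>Q\<close> cover the
  graph, and that of \<open>u\<close> has at most \<open>degree S u + 1\<close> elements.\<close>

lemma exists_large_degree:
  assumes S: "simple_graph S" "verts S \<noteq> {}" and Q: "Q \<subseteq> verts S"
    and dom: "\<forall>v\<in>verts S - Q. \<exists>u\<in>Q. {u, v} \<in> edges S"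
  shows "\<exists>u\<in>Q. card (verts S) \<le> card Q * (degree S u + 1)"
proof (rule ccontr)
  assume "\<not> ?thesis"
  then have small: "card Q * (degree S u + 1) < card (verts S)" if "u \<in> Q" for u
    using that by (simp add: not_le)
  have fin: "finite (verts S)" "finite Q" using S(1) Q finite_subset by (auto simp: simple_graph_def)
  have "Q \<noteq> {}" using S(2) dom by blast
  have finE: "finite (edges S)"
    by (rule finite_subset[of _ "Pow (verts S)"]) (use S fin in \<open>auto simp: simple_graph_def\<close>)
  let ?N = "\<lambda>u. insert u {v. {u, v} \<in> edges S}"
  have N: "card (?N u) \<le> degree S u + 1" "finite (?N u)" for u
  proof -
    have inj: "inj_on (\<lambda>v. {u, v}) {v. {u, v} \<in> edges S}" by (auto simp: inj_on_def doubleton_eq_iff)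
    have sub: "(\<lambda>v. {u, v}) ` {v. {u, v} \<in> edges S} \<subseteq> {e \<in> edges S. u \<in> e}" by auto
    have "card {v. {u, v} \<in> edges S} \<le> degree S u"
      unfolding degree_def using inj sub finE by (intro card_inj_on_le) auto
    moreover have "finite {v. {u, v} \<in> edges S}"
      using finite_subset[OF sub] finE finite_imageD[OF _ inj] by simp
    ultimately show "card (?N u) \<le> degree S u + 1" "finite (?N u)"
      using card_insert_le_m1[of "degree S u + 1" "{v. {u, v} \<in> edges S}" u] by auto
  qed
  have "verts S \<subseteq> (\<Union>u\<in>Q. ?N u)" using dom by blast
  then have "card (verts S) \<le> card (\<Union>u\<in>Q. ?N u)" using fin N by (intro card_mono) auto
  also have "\<dots> \<le> (\<Sum>u\<in>Q. card (?N u))" using fin by (intro card_UN_le) auto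
  also have "\<dots> \<le> (\<Sum>u\<in>Q. degree S u + 1)" using N by (intro sum_mono)
  \<comment> \<open>The factor \<open>card Q\<close> keeps the averaging in the natural numbers,
    without division.\<close>
  finally have "card Q * card (verts S) \<le> (\<Sum>u\<in>Q. card Q * (degree S u + 1))"
    unfolding sum_distrib_left[symmetric] by (rule mult_le_mono2)
  also have "\<dots> < (\<Sum>u\<in>Q. card (verts S))" using small fin \<open>Q \<noteq> {}\<close> by (intro sum_strict_mono) auto
  finally show False by simp
qed

lemma exists_popular_colour:
  assumes "finite A" "card (c ` A) \<le> k" "k * x < card A"
  shows "\<exists>j\<in>c ` A. x < card {a \<in> A. c a = j}"
proof (rule ccontr)
  assume "\<not> ?thesis"
  then have small: "card {a \<in> A. c a = j} \<le> x" if "j \<in> c ` A" for j using that by (metis not_less)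
  have "A = (\<Union>j\<in>c ` A. {a \<in> A. c a = j})" by auto
  then have "card A \<le> (\<Sum>j\<in>c ` A. card {a \<in> A. c a = j})"
    using card_UN_le[of "c ` A" "\<lambda>j. {a \<in> A. c a = j}"] assms(1) by simp
  also have "\<dots> \<le> card (c ` A) * x" using small sum_bounded_above[of "c ` A" _ x] by simp
  also have "\<dots> \<le> k * x" using assms(2) by simp
  finally show False using assms(3) by simp
qed

text \<open>Put \<open>L = l + 1\<close>. Summing over the spine, colour 1 has at most
  \<open>3 * L * n / r\<close> edges in \<open>S\<close>. Some spine vertex has degree above
  \<open>n / (2 * L)\<close> and sees at most \<open>15 * m\<close> colours, so one colour has more
  than \<open>n / (30 * L * m)\<close> edges or at least beats colour 1 there;
  \<open>large(1)\<close> makes the comparison succeed.\<close>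

lemma colour_1_not_dominant:
  assumes bal: "balanced_colouring r (complete_graph n) c"
    and deg1: "\<forall>v. real (card {e \<in> edges (complete_graph n). v \<in> e \<and> c e = 1}) \<le> 3 * real n / real r"
    and loc: "\<forall>v. card (c ` {e \<in> edges (complete_graph n). v \<in> e}) \<le> 15 * m"
    and cat: "caterpillar l H" and n: "card (verts H) = n" and copy: "is_copy S H (complete_graph n)"
    and r: "0 < r" and large: "180 * (real l + 1)\<^sup>2 * real m \<le> real r" "2 * (l + 1) < n"
  shows "\<exists>j\<in>{2..r}. colour_count S c 1 < colour_count S c j"
proof -
  let ?E = "edges (complete_graph n)"
  have S: "simple_graph S" "edges S \<subseteq> ?E" using copy by (auto simp: is_copy_def subgraph_def)
  have finE: "finite (edges S)" using S(2) finite_subset finite_edges_complete_graph by blast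
  have cS: "card (verts S) = n"
    using copy n unfolding is_copy_def isomorphic_def by (metis bij_betw_same_card)
  have neS: "verts S \<noteq> {}" using cS large(2) by auto
  obtain Q where Q: "Q \<subseteq> verts S" "card Q = l + 1" "\<forall>e\<in>edges S. e \<inter> Q \<noteq> {}"
    "\<forall>v\<in>verts S - Q. \<exists>u\<in>Q. {u, v} \<in> edges S"
    using copy_caterpillar_spine[OF cat copy] by blast
  have finQ: "finite Q" using Q(2) by (simp add: card_ge_0_finite)
  obtain u where u: "n \<le> (l + 1) * (degree S u + 1)"
    using exists_large_degree[OF S(1) neS Q(1,4)] cS Q(2) by auto
  let ?x = "colour_count S c 1"
  let ?D = "{e \<in> edges S. u \<in> e}"
  define L where "L = real l + 1"
  have L: "1 \<le> L" by (simp add: L_def)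
  have "?x \<le> card (\<Union>q\<in>Q. {e \<in> ?E. q \<in> e \<and> c e = 1})"
    unfolding colour_count_def using finQ S(2) Q(3) by (intro card_mono) auto
  also have "\<dots> \<le> (\<Sum>q\<in>Q. card {e \<in> ?E. q \<in> e \<and> c e = 1})" using finQ by (intro card_UN_le) auto
  finally have "real ?x \<le> (\<Sum>q\<in>Q. real (card {e \<in> ?E. q \<in> e \<and> c e = 1}))"
    by (simp flip: of_nat_sum)
  also have "\<dots> \<le> real (card Q) * (3 * real n / real r)" using deg1 by (intro sum_bounded_above) auto
  finally have x: "real ?x \<le> L * (3 * real n / real r)" using Q(2) by (simp add: L_def add.commute)
  have "real n \<le> L * (real (card ?D) + 1)"
  proof -
    have "real n \<le> real ((l + 1) * (card ?D + 1))" using u by (simp only: of_nat_le_iff degree_def)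
    then show ?thesis by (simp add: L_def algebra_simps)
  qed
  moreover have "2 * L < real n" using large(2) by (simp add: L_def)
  \<comment> \<open>The additive \<open>L\<close> is less than half of \<open>n\<close>, which
    leaves more than half of \<open>n\<close> for \<open>L * real (card ?D)\<close>.\<close>
  ultimately have D: "real n < 2 * L * real (card ?D)" by (simp add: algebra_simps)
  have "2 * L * (real (15 * m) * real ?x) \<le> 2 * L * (real (15 * m) * (L * (3 * real n / real r)))"
    using x L by (intro mult_left_mono) auto
  \<comment> \<open>The constant is 2 * 15 * 3 = 90, within the 180 granted by
    \<open>large(1)\<close>.\<close>
  also have "\<dots> = (90 * L\<^sup>2 * real m) * (real n / real r)" by (simp add: power2_eq_square)
  also have "\<dots> \<le> real r * (real n / real r)"
    using large(1) by (intro mult_right_mono) (auto simp: L_def add.commute)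
  also have "\<dots> = real n" using r by simp
  also note D
  finally have "real (15 * m * ?x) < real (card ?D)" using L by simp
  then have lt: "15 * m * ?x < card ?D" by (simp only: of_nat_less_iff)
  have "card (c ` ?D) \<le> card (c ` {e \<in> ?E. u \<in> e})" using S(2) by (intro card_mono) auto
  also have "\<dots> \<le> 15 * m" using loc by blast
  finally obtain j where j: "j \<in> c ` ?D" "?x < card {e \<in> ?D. c e = j}"
    using exists_popular_colour[OF _ _ lt, of c] finE by auto
  have "card {e \<in> ?D. c e = j} \<le> colour_count S c j"
    unfolding colour_count_def using finE by (intro card_mono) auto
  then have less: "?x < colour_count S c j" using j(2) by simp
  moreover have "j \<in> {1..r}" using j(1) S(2) bal by (auto simp: balanced_colouring_def edge_colouring_def)
  moreover have "j \<noteq> 1" using less by auto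
  ultimately show ?thesis by (intro bexI[of _ j]) auto
qed

section \<open>Choice of parameters and conclusion\<close>

text \<open>Here \<open>m\<close> is about \<open>sqrt r\<close>, and the bound amounts to \<open>sqrt \<epsilon>\<close> being small.\<close>

lemma parameter_choice:
  fixes \<epsilon> :: real and r :: nat
  assumes \<epsilon>: "0 < \<epsilon>" "\<epsilon> < 1 / 10 ^ 8" and r: "1 / \<epsilon> ^ 5 \<le> real r"
  shows "\<exists>m::nat. r \<le> m\<^sup>2 \<and> m \<le> r \<and> 4 \<le> r \<and> 180 * (real (nat \<lceil>1 / \<epsilon>\<rceil>) + 1)\<^sup>2 * real m \<le> real r"
proof -
  define E where "E = 1 / \<epsilon>"
  have E: "10 ^ 8 \<le> E" using \<epsilon> by (simp add: E_def field_simps)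
  have r5: "E ^ 5 \<le> real r" using r by (simp add: E_def power_divide)
  define q where "q = sqrt (real r)"
  have qq: "q * q = real r" and q0: "0 \<le> q" by (simp_all add: q_def)
  \<comment> \<open>One factor \<open>E\<close> of the fifth power is spent on the constant
    \<open>10 ^ 8\<close>; the remaining \<open>E ^ 4\<close> puts \<open>q\<close> above a large
    multiple of \<open>E\<^sup>2\<close>.\<close>
  have E5: "(10 ^ 4 * E\<^sup>2)\<^sup>2 \<le> E ^ 5"
  proof -
    have "(10 ^ 4 * E\<^sup>2)\<^sup>2 = 10 ^ 8 * E ^ 4" by (simp add: power_mult_distrib)
    also have "\<dots> \<le> E * E ^ 4" using E by (intro mult_right_mono) auto
    finally show ?thesis by (simp flip: power_Suc)
  qed
  have q: "10 ^ 4 * E\<^sup>2 \<le> q"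
    unfolding q_def using E5 r5 by (intro real_le_rsqrt) simp
  have "1 \<le> E\<^sup>2" using E by (intro one_le_power) simp
  then have q4: "10 ^ 4 \<le> q" using q by simp
  \<comment> \<open>Rounding up secures \<open>r \<le> m\<^sup>2\<close>, and \<open>m\<close> still
    stays below \<open>2 * q\<close>.\<close>
  define m where "m = nat \<lceil>q\<rceil>"
  have m: "q \<le> real m" "real m \<le> q + 1" using q0 unfolding m_def by linarith+
  have "real r \<le> (real m)\<^sup>2" unfolding qq[symmetric] power2_eq_square using m q0 by (intro mult_mono) auto
  then have "r \<le> m\<^sup>2" by (simp flip: of_nat_power)
  moreover have "4 * q \<le> q * q" using q4 by (intro mult_right_mono) auto
  then have "real m \<le> real r" "4 \<le> real r" using m q4 qq by auto
  moreover have "180 * (real (nat \<lceil>1 / \<epsilon>\<rceil>) + 1)\<^sup>2 * real m \<le> real r"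
  proof -
    have "real (nat \<lceil>1 / \<epsilon>\<rceil>) + 1 \<le> 2 * E"
    proof -
      have "4 \<le> E" using E by simp
      then show ?thesis unfolding E_def by linarith
    qed
    then have "(real (nat \<lceil>1 / \<epsilon>\<rceil>) + 1)\<^sup>2 \<le> (2 * E)\<^sup>2" by (intro power_mono) auto
    then have "180 * (real (nat \<lceil>1 / \<epsilon>\<rceil>) + 1)\<^sup>2 * real m \<le> 180 * (2 * E)\<^sup>2 * (2 * q)"
      using m q4 by (intro mult_mono) auto
    \<comment> \<open>Here 1440 = 180 * 4 * 2, well below the \<open>10 ^ 4\<close> in the lower
      bound for \<open>q\<close>.\<close>
    also have "\<dots> = (1440 * E\<^sup>2) * q" by (simp add: power_mult_distrib)
    also have "\<dots> \<le> q * q" using q q0 E by (intro mult_right_mono) auto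
    finally show ?thesis using qq by simp
  qed
  ultimately show ?thesis by auto
qed

theorem proposition1p3:
  "\<exists>\<epsilon>\<^sub>0::real. 0 < \<epsilon>\<^sub>0 \<and>
     (\<forall>\<epsilon>::real. 0 < \<epsilon> \<and> \<epsilon> < 1 \<and> \<epsilon> < \<epsilon>\<^sub>0 \<longrightarrow>
       (\<forall>r::nat. real r \<ge> 1 / \<epsilon> ^ 5 \<longrightarrow>
         (\<exists>N::nat. \<forall>n\<ge>N. \<exists>c :: nat set \<Rightarrow> nat.
            balanced_colouring r (complete_graph n) c \<and>
            (\<forall>(H :: nat graph) (S :: nat graph).
               caterpillar (nat \<lceil>1 / \<epsilon>\<rceil>) H \<and> card (verts H) = n \<and>
               is_copy S H (complete_graph n) \<longrightarrow>
               (\<exists>j\<in>{2..r}. colour_count S c 1 < colour_count S c j)))))"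
proof (intro exI[of _ "1 / 10 ^ 8"] conjI allI impI)
  fix \<epsilon> :: real and r :: nat
  assume \<epsilon>: "0 < \<epsilon> \<and> \<epsilon> < 1 \<and> \<epsilon> < 1 / 10 ^ 8" and r: "1 / \<epsilon> ^ 5 \<le> real r"
  define l where "l = nat \<lceil>1 / \<epsilon>\<rceil>"
  obtain m where m: "r \<le> m\<^sup>2" "m \<le> r" "4 \<le> r" "180 * (real l + 1)\<^sup>2 * real m \<le> real r"
    using parameter_choice[of \<epsilon> r] \<epsilon> r unfolding l_def by blast
  show "\<exists>N::nat. \<forall>n\<ge>N. \<exists>c :: nat set \<Rightarrow> nat. balanced_colouring r (complete_graph n) c \<and>
    (\<forall>(H :: nat graph) (S :: nat graph).
       caterpillar (nat \<lceil>1 / \<epsilon>\<rceil>) H \<and> card (verts H) = n \<and> is_copy S H (complete_graph n) \<longrightarrow>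
       (\<exists>j\<in>{2..r}. colour_count S c 1 < colour_count S c j))"
    unfolding l_def[symmetric]
  \<comment> \<open>The summand \<open>100 * r\<close> serves the colouring, and
    \<open>2 * (l + 1) + 1\<close> the strict inequality \<open>2 * (l + 1) < n\<close> for the
    spine.\<close>
  proof (intro exI[of _ "100 * r + 2 * (l + 1) + 1"] allI impI)
    fix n assume n: "100 * r + 2 * (l + 1) + 1 \<le> n"
    then have "100 * r \<le> n" by simp
    from exists_local_balanced_colouring[OF m(3,1,2) this] obtain c where
      c: "balanced_colouring r (complete_graph n) c"
      "\<forall>v. real (card {e \<in> edges (complete_graph n). v \<in> e \<and> c e = 1}) \<le> 3 * real n / real r"
      "\<forall>v. card (c ` {e \<in> edges (complete_graph n). v \<in> e}) \<le> 15 * m" by blast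
    have "0 < r" "2 * (l + 1) < n" using m(3) n by auto
    then show "\<exists>c. balanced_colouring r (complete_graph n) c \<and>
      (\<forall>(H :: nat graph) (S :: nat graph).
        caterpillar l H \<and> card (verts H) = n \<and> is_copy S H (complete_graph n) \<longrightarrow>
        (\<exists>j\<in>{2..r}. colour_count S c 1 < colour_count S c j))"
      using c colour_1_not_dominant[OF c _ _ _ _ m(4)] by blast
  qed
qed simp

end
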